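(* For any sequence of functions $\{a_n\}_{n\in\mathbb{N}}$, any BDF order $k\ge1$ and any $n\ge k$, there exist unique coefficients $\beta_{j\ell}$ for $1\le j\le k$ and $0\le\ell\le k-j$ such that $$\sum_{j=0}^k\delta_ja_{n-j}^2-2\Big(\sum_{j=0}^k\delta_ja_{n-j}\Big)\Big(\sum_{j=0}^{k-1}\gamma_ja_{n-j-1}\Big)=\sum_{j=1}^k\sum_{\ell=0}^{k-j}\beta_{j\ell}\,s^{2j}\,(d_t^ja_{n-\ell})^2 .$$
   Context: Here $s>0$ is a step size and $\mathbb{N}=\{0,1,2,\dots\}$. BDF-$k$ coefficients: $\delta_0=\sum_{r=1}^k\frac1r$, $\delta_i=\frac{(-1)^i}{i}\binom{k}{i}$ for $1\le i\le k$, and $\gamma_j=(-1)^j\binom{k}{j+1}$ for $0\le j\le k-1$. Backward differences: $d_ta_n=(a_n-a_{n-1})/s$ and $d_t^ja_n=(d_t^{j-1}a_n-d_t^{j-1}a_{n-1})/s$ for $j\ge2$, so that $d_t^ja_n=s^{-j}\sum_{m=0}^j(-1)^m\binom{j}{m}a_{n-m}$.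
   Formalization: Uniqueness is for coefficients making the identity hold for all sequences (at a given s and n), since for a single fixed sequence, e.g. a = 0, the coefficients are not unique; existence gives one family depending only on k. *)

theory Defs
  imports Complex_Main
begin

definition bdf_delta :: "nat \<Rightarrow> nat \<Rightarrow> real" where
  "bdf_delta k i =
     (if i = 0 then (\<Sum>r=1..k. 1 / real r) else (-1) ^ i / real i * real (k choose i))"

definition bdf_gamma :: "nat \<Rightarrow> nat \<Rightarrow> real" where
  "bdf_gamma k j = (-1) ^ j * real (k choose (j + 1))"

text \<open>
  \<open>bdiff s j a n\<close> is the \<open>j\<close>-th backward difference quotient
  of the sequence of functions \<open>a\<close> at index \<open>n\<close>. It is meaningful for \<open>j \<le> n\<close> only:
  for smaller \<open>n\<close> the index \<open>n - 1\<close> is eventually truncated at \<open>0\<close>.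
\<close>

primrec bdiff :: "real \<Rightarrow> nat \<Rightarrow> (nat \<Rightarrow> 'x \<Rightarrow> real) \<Rightarrow> nat \<Rightarrow> 'x \<Rightarrow> real" where
  "bdiff s 0 a = a"
| "bdiff s (Suc j) a = (\<lambda>n x. (bdiff s j a n x - bdiff s j a (n - 1) x) / s)"

text \<open>
  The identity is an equality of functions, hence required at every point. All indices are
  nonnegative without truncation when \<open>1 \<le> k \<le> n\<close>.
\<close>

definition bdf_identity ::
  "nat \<Rightarrow> (nat \<Rightarrow> nat \<Rightarrow> real) \<Rightarrow> real \<Rightarrow> nat \<Rightarrow> (nat \<Rightarrow> 'x \<Rightarrow> real) \<Rightarrow> bool" where
  "bdf_identity k \<beta> s n a \<longleftrightarrow> (\<forall>x.
     (\<Sum>j=0..k. bdf_delta k j * (a (n - j) x)\<^sup>2)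
       - 2 * (\<Sum>j=0..k. bdf_delta k j * a (n - j) x)
           * (\<Sum>j=0..k - 1. bdf_gamma k j * a (n - j - 1) x)
     = (\<Sum>j=1..k. \<Sum>l=0..k - j. \<beta> j l * s ^ (2 * j) * (bdiff s j a (n - l) x)\<^sup>2))"

end

theory Submission
  imports Defs
begin

text \<open>
  Existence: as the \<open>\<delta>\<^sub>j\<close> sum to \<open>0\<close> and the \<open>\<gamma>\<^sub>j\<close> sum to \<open>1\<close>, the left-hand side
  equals \<open>\<Sum>\<delta>\<^sub>j (a\<^sub>n\<^sub>-\<^sub>j - g)\<^sup>2\<close> with \<open>g = \<Sum>\<gamma>\<^sub>j a\<^sub>n\<^sub>-\<^sub>j\<^sub>-\<^sub>1\<close>, which is a quadratic form in
  the first differences. A product of two \<open>j\<close>-th differences at positions \<open>p\<close> and \<open>q\<close> is a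
  combination of squares of differences of order at least \<open>j\<close>: in
  \<open>2 x y = x\<^sup>2 + y\<^sup>2 - (x - y)\<^sup>2\<close>, the difference \<open>x - y\<close> telescopes into differences of order
  \<open>j + 1\<close> at positions that are closer together than \<open>p\<close> and \<open>q\<close>.

  Uniqueness: \<open>a\<^sub>n\<^sub>-\<^sub>l\<close> and \<open>a\<^sub>n\<^sub>-\<^sub>l\<^sub>-\<^sub>j\<close> occur together only in the squares of \<open>d\<^sub>t\<^sup>j a\<^sub>n\<^sub>-\<^sub>l\<close> and of
  differences of higher order, so the coefficients are determined by descending
  induction on \<open>j\<close>.
\<close>

section \<open>Backward differences with the step size scaled out\<close>

text \<open>Here \<open>v i\<close> stands for \<open>a (n - i) x\<close>: positions are counted
  backwards from \<open>n\<close>, so no truncated subtraction occurs.\<close>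

primrec fdiff :: "nat \<Rightarrow> (nat \<Rightarrow> real) \<Rightarrow> nat \<Rightarrow> real" where
  "fdiff 0 v l = v l"
| "fdiff (Suc j) v l = fdiff j v l - fdiff j v (Suc l)"

lemma fdiff_add: "fdiff j (\<lambda>i. u i + v i) l = fdiff j u l + fdiff j v l"
  by (induction j arbitrary: l) auto

lemma fdiff_eq_0: "(\<And>i. i \<in> {l..l + j} \<Longrightarrow> v i = 0) \<Longrightarrow> fdiff j v l = 0"
  by (induction j arbitrary: l) auto

lemma fdiff_eq_first: "(\<And>i. i \<in> {l<..l + j} \<Longrightarrow> v i = 0) \<Longrightarrow> fdiff j v l = v l"
proof (induction j arbitrary: l)
  case (Suc j)
  then show ?case using fdiff_eq_0[of "Suc l" j v] by auto
qed simp

lemma fdiff_eq_last: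
  "(\<And>i. i \<in> {l..<l + j} \<Longrightarrow> v i = 0) \<Longrightarrow> fdiff j v l = (-1) ^ j * v (l + j)"
proof (induction j arbitrary: l)
  case (Suc j)
  then show ?case using fdiff_eq_0[of l j v] by auto
qed simp

lemma fdiff_telescope:
  assumes "p \<le> q"
  shows "fdiff j v p - fdiff j v q = (\<Sum>r=p..<q. fdiff (Suc j) v r)"
  using sum_Suc_diff'[of p q "\<lambda>r. - fdiff j v r"] assms by simp

lemma bdiff_eq_fdiff:
  assumes "s \<noteq> 0" "l + j \<le> n"
  shows "s ^ j * bdiff s j a (n - l) x = fdiff j (\<lambda>i. a (n - i) x) l"
  using assms(2)
proof (induction j arbitrary: l)
  case (Suc j)
  have "s ^ Suc j * bdiff s (Suc j) a (n - l) x
      = s ^ j * bdiff s j a (n - l) x - s ^ j * bdiff s j a (n - Suc l) x"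
    using assms(1) by (simp add: field_simps)
  then show ?case using Suc.IH[of l] Suc.IH[of "Suc l"] Suc.prems by simp
qed simp

section \<open>Combinations of squared differences\<close>

definition fdiff_form :: "nat \<Rightarrow> (nat \<Rightarrow> nat \<Rightarrow> real) \<Rightarrow> (nat \<Rightarrow> real) \<Rightarrow> real" where
  "fdiff_form k \<beta> v = (\<Sum>j=1..k. \<Sum>l=0..k - j. \<beta> j l * (fdiff j v l)\<^sup>2)"

lemma bdiff_form_eq_fdiff_form:
  assumes "s \<noteq> 0" "k \<le> n"
  shows "(\<Sum>j=1..k. \<Sum>l=0..k - j. \<beta> j l * s ^ (2 * j) * (bdiff s j a (n - l) x)\<^sup>2)
    = fdiff_form k \<beta> (\<lambda>i. a (n - i) x)"
  unfolding fdiff_form_def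
proof (intro sum.cong refl)
  fix j l assume "j \<in> {1..k}" "l \<in> {0..k - j}"
  then have "s ^ j * bdiff s j a (n - l) x = fdiff j (\<lambda>i. a (n - i) x) l"
    using assms by (intro bdiff_eq_fdiff) auto
  then show "\<beta> j l * s ^ (2 * j) * (bdiff s j a (n - l) x)\<^sup>2
      = \<beta> j l * (fdiff j (\<lambda>i. a (n - i) x) l)\<^sup>2"
    by (simp flip: power_mult_distrib add: power_even_eq mult.assoc)
qed

text \<open>Membership means that one choice of coefficients serves every \<open>v\<close>, so
  existence becomes a closure argument in a linear space.\<close>

definition fdiff_forms :: "nat \<Rightarrow> ((nat \<Rightarrow> real) \<Rightarrow> real) set" where
  "fdiff_forms k = range (fdiff_form k)"

lemma fdiff_form_add:
  "fdiff_form k \<beta> v + fdiff_form k \<beta>' v = fdiff_form k (\<lambda>j l. \<beta> j l + \<beta>' j l) v"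
  by (simp add: fdiff_form_def sum.distrib algebra_simps)

lemma fdiff_form_scale: "c * fdiff_form k \<beta> v = fdiff_form k (\<lambda>j l. c * \<beta> j l) v"
  by (simp add: fdiff_form_def sum_distrib_left algebra_simps)

lemma fdiff_forms_add:
  assumes "Q \<in> fdiff_forms k" "R \<in> fdiff_forms k"
  shows "(\<lambda>v. Q v + R v) \<in> fdiff_forms k"
  using assms by (auto simp: fdiff_forms_def fdiff_form_add)

lemma fdiff_forms_scale:
  assumes "Q \<in> fdiff_forms k"
  shows "(\<lambda>v. c * Q v) \<in> fdiff_forms k"
  using assms by (auto simp: fdiff_forms_def fdiff_form_scale)

lemma fdiff_forms_sum:
  assumes "\<And>i. i \<in> A \<Longrightarrow> Q i \<in> fdiff_forms k"
  shows "(\<lambda>v. \<Sum>i\<in>A. Q i v) \<in> fdiff_forms k"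
proof -
  have "(\<lambda>v. 0) = fdiff_form k (\<lambda>_ _. 0)" by (simp add: fdiff_form_def fun_eq_iff)
  then have "(\<lambda>v. 0) \<in> fdiff_forms k" by (simp add: fdiff_forms_def)
  with assms show ?thesis
    by (induction A rule: infinite_finite_induct) (auto intro: fdiff_forms_add)
qed

lemma fdiff_square_in_fdiff_forms:
  assumes "1 \<le> j" "l + j \<le> k"
  shows "(\<lambda>v. (fdiff j v l)\<^sup>2) \<in> fdiff_forms k"
proof -
  \<comment> \<open>Nested conditionals, unlike a conjunction, let the two sums collapse one after
    the other.\<close>
  define \<beta> :: "nat \<Rightarrow> nat \<Rightarrow> real"
    where "\<beta> = (\<lambda>i m. if i = j then if m = l then 1 else 0 else 0)"
  have "fdiff_form k \<beta> v = (fdiff j v l)\<^sup>2" for v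
  proof -
    have "fdiff_form k \<beta> v
      = (\<Sum>i=1..k. if i = j then \<Sum>m=0..k - i. if m = l then (fdiff i v m)\<^sup>2 else 0 else 0)"
      unfolding fdiff_form_def \<beta>_def
      by (intro sum.cong) (auto simp: if_distrib[of "\<lambda>c. c * _"] cong: if_cong)
    then show ?thesis using assms by (simp split: if_splits)
  qed
  then have "(\<lambda>v. (fdiff j v l)\<^sup>2) = fdiff_form k \<beta>" by (simp add: fun_eq_iff)
  then show ?thesis by (simp add: fdiff_forms_def)
qed

lemma fdiff_product_in_fdiff_forms:
  assumes "1 \<le> j" "p + j \<le> k" "q + j \<le> k"
  shows "(\<lambda>v. fdiff j v p * fdiff j v q) \<in> fdiff_forms k"
proof -
  have le: "(\<lambda>v. fdiff j v p * fdiff j v (p + d)) \<in> fdiff_forms k"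
    if "1 \<le> j" "p + d + j \<le> k" for j p d
    using that
  proof (induction d arbitrary: j p rule: less_induct)
    case (less d)
    \<comment> \<open>Two positions in \<open>{p..<p + d}\<close> are less than \<open>d\<close>
      apart, and \<open>r + Suc j \<le> p + d + j \<le> k\<close> keeps the raised order
      admissible.\<close>
    have closer: "(\<lambda>v. fdiff (Suc j) v r * fdiff (Suc j) v t) \<in> fdiff_forms k"
      if "r \<in> {p..<p + d}" "t \<in> {p..<p + d}" for r t
    proof (cases "r \<le> t")
      case True
      then show ?thesis using less.IH[of "t - r" "Suc j" r] less.prems that by simp
    next
      case False
      then show ?thesis using less.IH[of "r - t" "Suc j" t] less.prems that
        by (simp add: mult.commute)
    qed
    \<comment> \<open>The double sum is the square of the telescoped difference; for
      \<open>d = 0\<close> it is empty.\<close>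
    have "fdiff j v p * fdiff j v (p + d)
      = 1/2 * ((fdiff j v p)\<^sup>2 + (fdiff j v (p + d))\<^sup>2
          + (- 1) * (\<Sum>r=p..<p + d. \<Sum>t=p..<p + d. fdiff (Suc j) v r * fdiff (Suc j) v t))" for v
      unfolding sum_product[symmetric] fdiff_telescope[OF le_add1, symmetric]
      by (simp add: power2_eq_square algebra_simps)
    moreover have "(\<lambda>v. 1/2 * ((fdiff j v p)\<^sup>2 + (fdiff j v (p + d))\<^sup>2
        + (- 1) * (\<Sum>r=p..<p + d. \<Sum>t=p..<p + d. fdiff (Suc j) v r * fdiff (Suc j) v t)))
      \<in> fdiff_forms k"
      using less.prems closer
      by (intro fdiff_forms_scale fdiff_forms_add fdiff_forms_sum fdiff_square_in_fdiff_forms) auto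
    ultimately show ?case by (simp only:)
  qed
  show ?thesis
  proof (cases "p \<le> q")
    case True
    then show ?thesis using le[of j p "q - p"] assms by simp
  next
    case False
    then show ?thesis using le[of j q "p - q"] assms by (simp add: mult.commute)
  qed
qed

text \<open>Each increment is, up to sign, a sum of first differences, so the product expands into
  products of first differences.\<close>

lemma increment_product_in_fdiff_forms:
  assumes "p \<le> k" "q \<le> k" "p' \<le> k" "q' \<le> k"
  shows "(\<lambda>v. (v p - v q) * (v p' - v q')) \<in> fdiff_forms k"
proof -
  have tel: "v p - v q = (if p \<le> q then 1 else -1) * (\<Sum>r=min p q..<max p q. fdiff 1 v r)"
    for v p q
    using fdiff_telescope[of p q 0 v] fdiff_telescope[of q p 0 v] by (auto simp: min_def max_def)
  have "(\<lambda>v. (v p - v q) * (v p' - v q'))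
    = (\<lambda>v. ((if p \<le> q then 1 else -1) * (if p' \<le> q' then 1 else -1)) *
        (\<Sum>r=min p q..<max p q. \<Sum>t=min p' q'..<max p' q'. fdiff 1 v r * fdiff 1 v t))"
    unfolding sum_product[symmetric] by (simp only: tel[of _ p q] tel[of _ p' q'] mult_ac)
  then show ?thesis using assms
    by (simp only:)
       (intro fdiff_forms_scale fdiff_forms_sum fdiff_product_in_fdiff_forms; auto)
qed

section \<open>Sums of the BDF coefficients\<close>

text \<open>Passing from \<open>k\<close> to \<open>Suc k\<close>, Pascal's rule and the absorption
  identity change the sum over \<open>i \<ge> 1\<close> by an alternating binomial sum over
  \<open>Suc k\<close>. Without its term at \<open>i = 0\<close> that sum is \<open>-1\<close>,
  which yields the next harmonic term.\<close>

lemma bdf_delta_sum: "(\<Sum>j=0..k. bdf_delta k j) = 0"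
proof -
  have "(\<Sum>i=1..k. (-1) ^ i / real i * real (k choose i)) = - (\<Sum>r=1..k. 1 / real r)"
  proof (induction k)
    case (Suc k)
    have pascal: "(-1) ^ i / real i * real (Suc k choose i)
      = (-1) ^ i / real i * real (k choose i)
        + (-1) ^ i * real (Suc k choose i) / real (Suc k)" if "i \<in> {1..Suc k}" for i
    proof -
      obtain m where i: "i = Suc m" using \<open>i \<in> {1..Suc k}\<close> by (cases i) simp_all
      have "real (Suc m) * real (Suc k choose Suc m) = real (Suc k) * real (k choose m)"
        unfolding of_nat_mult[symmetric] by (simp only: Suc_times_binomial)
      then have "real (k choose m) / real i = real (Suc k choose i) / real (Suc k)"
        using i by (simp add: frac_eq_eq mult.commute del: binomial_Suc_Suc)
      moreover have "real (Suc k choose i) = real (k choose m) + real (k choose i)"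
        using i by simp
      ultimately show ?thesis
        by (simp add: add_divide_distrib distrib_left flip: times_divide_eq_right)
    qed
    have "(\<Sum>i=0..Suc k. (-1) ^ i * real (Suc k choose i)) = 0"
      using choose_alternating_sum[of "Suc k"] by (simp add: atMost_atLeast0)
    then have alt: "(\<Sum>i=1..Suc k. (-1) ^ i * real (Suc k choose i)) = - 1"
      by (subst (asm) sum.atLeast_Suc_atMost) (simp_all del: binomial_Suc_Suc)
    have "(\<Sum>i=1..Suc k. (-1) ^ i / real i * real (Suc k choose i))
      = (\<Sum>i=1..Suc k. (-1) ^ i / real i * real (k choose i))
        + (\<Sum>i=1..Suc k. (-1) ^ i * real (Suc k choose i)) / real (Suc k)"
      unfolding sum_divide_distrib sum.distrib[symmetric] using pascal by (rule sum.cong[OF refl])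
    \<comment> \<open>The extra term at \<open>i = Suc k\<close> vanishes because
      \<open>k choose Suc k\<close> is 0.\<close>
    then show ?case unfolding alt using Suc.IH by (simp add: binomial_eq_0)
  qed simp
  moreover have "(\<Sum>j=1..k. bdf_delta k j) = (\<Sum>i=1..k. (-1) ^ i / real i * real (k choose i))"
    by (intro sum.cong) (auto simp: bdf_delta_def)
  moreover have "(\<Sum>j=0..k. bdf_delta k j) = bdf_delta k 0 + (\<Sum>j=1..k. bdf_delta k j)"
    by (simp add: sum.atLeast_Suc_atMost)
  ultimately show ?thesis by (simp add: bdf_delta_def)
qed

lemma bdf_gamma_sum:
  assumes "1 \<le> k"
  shows "(\<Sum>j=0..k - 1. bdf_gamma k j) = 1"
proof -
  have "(\<Sum>i=0..Suc (k - 1). (-1) ^ i * real (k choose i)) = 0"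
    using choose_alternating_sum[of k] assms by (simp add: atMost_atLeast0)
  then show ?thesis
    by (subst (asm) sum.atLeast0_atMost_Suc_shift) (simp add: bdf_gamma_def sum_negf)
qed

section \<open>Existence of the coefficients\<close>

lemma bdf_form_in_fdiff_forms:
  assumes "1 \<le> k"
  shows "(\<lambda>v. (\<Sum>j=0..k. bdf_delta k j * (v j)\<^sup>2)
      - 2 * (\<Sum>j=0..k. bdf_delta k j * v j) * (\<Sum>j=0..k - 1. bdf_gamma k j * v (j + 1)))
    \<in> fdiff_forms k" (is "?Q \<in> _")
proof -
  have "?Q v = (\<Sum>j=0..k. bdf_delta k j * (\<Sum>i=0..k - 1. \<Sum>i'=0..k - 1.
      (bdf_gamma k i * bdf_gamma k i') * ((v j - v (i + 1)) * (v j - v (i' + 1)))))" for v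
  proof -
    define g where "g = (\<Sum>j=0..k - 1. bdf_gamma k j * v (j + 1))"
    have centred: "v j - g = (\<Sum>i=0..k - 1. bdf_gamma k i * (v j - v (i + 1)))" for j
      using bdf_gamma_sum[OF assms]
      by (simp add: g_def right_diff_distrib sum_subtractf flip: sum_distrib_right)
    \<comment> \<open>The added \<open>g\<^sup>2\<close> term is zero and completes the
      squares.\<close>
    have "?Q v = (\<Sum>j=0..k. bdf_delta k j * (v j)\<^sup>2)
        - 2 * (\<Sum>j=0..k. bdf_delta k j * v j) * g + (\<Sum>j=0..k. bdf_delta k j) * g\<^sup>2"
      by (simp add: g_def bdf_delta_sum)
    also have "\<dots> = (\<Sum>j=0..k. bdf_delta k j * ((v j - g) * (v j - g)))"
      by (simp add: power2_eq_square algebra_simps sum.distrib sum_subtractf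
          sum_distrib_left sum_distrib_right)
    finally show ?thesis
      unfolding centred sum_product by (simp add: mult_ac)
  qed
  then show ?thesis using assms
    by (simp only:)
       (intro fdiff_forms_sum fdiff_forms_scale increment_product_in_fdiff_forms; auto)
qed

section \<open>Uniqueness of the coefficients\<close>

lemma fdiff_form_coeffs_eq_0:
  assumes zero: "\<And>v. fdiff_form k \<beta> v = 0" and "1 \<le> j" "j + l \<le> k"
  shows "\<beta> j l = 0"
  using assms(2,3)
proof (induction "k - j" arbitrary: j l rule: less_induct)
  case less
  \<comment> \<open>Unit vectors at the two ends of the stencil of \<open>fdiff j v l\<close>, on
    which this difference takes the values \<open>1\<close> and \<open>(-1) ^ j\<close>.\<close>
  let ?u = "\<lambda>i. if i = l then 1 else 0 :: real"
  let ?w = "\<lambda>i. if i = l + j then 1 else 0 :: real"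
  \<comment> \<open>A vanishing quadratic form has a vanishing polar form.\<close>
  have polar: "(\<Sum>i=1..k. \<Sum>m=0..k - i. \<beta> i m * (fdiff i ?u m * fdiff i ?w m)) = 0"
  proof -
    have "2 * (\<Sum>i=1..k. \<Sum>m=0..k - i. \<beta> i m * (fdiff i ?u m * fdiff i ?w m))
      = fdiff_form k \<beta> (\<lambda>i. ?u i + ?w i) - fdiff_form k \<beta> ?u - fdiff_form k \<beta> ?w"
      unfolding fdiff_form_def fdiff_add
      by (simp add: power2_eq_square algebra_simps sum.distrib sum_distrib_left)
    then show ?thesis by (simp add: zero)
  qed
  have "\<beta> i m * (fdiff i ?u m * fdiff i ?w m)
      = (if i = j then if m = l then \<beta> j l * (-1) ^ j else 0 else 0)"
    if "i \<in> {1..k}" "m \<in> {0..k - i}" for i m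
  proof (cases "i = j \<and> m = l")
    case True
    then show ?thesis
      using fdiff_eq_first[of l j ?u] fdiff_eq_last[of l j ?w] less.prems by simp
  next
    case False
    \<comment> \<open>Either the order is higher and the induction hypothesis applies, or the
      stencil from \<open>m\<close> to \<open>m + i\<close> misses \<open>l\<close> or
      \<open>l + j\<close>.\<close>
    consider "i > j" | "l < m" | "m + i < l + j" using False by linarith
    then have "\<beta> i m * (fdiff i ?u m * fdiff i ?w m) = 0"
    proof cases
      case 1
      then have "\<beta> i m = 0" using less.hyps[of i m] that by auto
      then show ?thesis by simp
    next
      case 2
      then show ?thesis using fdiff_eq_0[of m i ?u] by auto
    next
      case 3
      then show ?thesis using fdiff_eq_0[of m i ?w] by auto
    qed
    with False show ?thesis by auto
  qed
  then have "(\<Sum>i=1..k. \<Sum>m=0..k - i. if i = j then if m = l then \<beta> j l * (-1) ^ j else 0 else 0) = 0"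
    using polar by simp
  moreover have "(\<Sum>i=1..k. \<Sum>m=0..k - i. if i = j then if m = l then \<beta> j l * (-1) ^ j else 0 else 0)
      = (\<Sum>i=1..k. if i = j then \<Sum>m=0..k - i. if m = l then \<beta> j l * (-1) ^ j else 0 else 0)"
    by (intro sum.cong) auto
  ultimately show ?case using less.prems by (simp split: if_splits)
qed

theorem lemma3p1:
  fixes k :: nat
  assumes "k \<ge> 1"
  shows "\<exists>\<beta> :: nat \<Rightarrow> nat \<Rightarrow> real.
    (\<forall>s>0. \<forall>n\<ge>k. \<forall>a :: nat \<Rightarrow> 'x \<Rightarrow> real. bdf_identity k \<beta> s n a) \<and>
    (\<forall>s>0. \<forall>n\<ge>k. \<forall>\<beta>' :: nat \<Rightarrow> nat \<Rightarrow> real.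
       (\<forall>a :: nat \<Rightarrow> 'x \<Rightarrow> real. bdf_identity k \<beta>' s n a) \<longrightarrow>
       (\<forall>j\<in>{1..k}. \<forall>l\<in>{0..k - j}. \<beta>' j l = \<beta> j l))"
proof -
  obtain \<beta> where \<beta>: "(\<Sum>j=0..k. bdf_delta k j * (v j)\<^sup>2)
      - 2 * (\<Sum>j=0..k. bdf_delta k j * v j) * (\<Sum>j=0..k - 1. bdf_gamma k j * v (j + 1))
      = fdiff_form k \<beta> v" for v
    using bdf_form_in_fdiff_forms[OF assms] unfolding fdiff_forms_def image_iff fun_eq_iff by blast
  \<comment> \<open>Neither \<open>s\<close> nor \<open>n\<close> enters \<open>fdiff_form\<close>,
    so one \<open>\<beta>\<close> serves all of them.\<close>
  have identity_iff: "bdf_identity k \<beta>' s n a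
      \<longleftrightarrow> (\<forall>x. fdiff_form k \<beta> (\<lambda>i. a (n - i) x) = fdiff_form k \<beta>' (\<lambda>i. a (n - i) x))"
    if "s > 0" "n \<ge> k" for s n \<beta>' and a :: "nat \<Rightarrow> 'x \<Rightarrow> real"
    unfolding bdf_identity_def \<beta>[symmetric]
    using that by (subst bdiff_form_eq_fdiff_form) auto
  have "\<beta>' j l = \<beta> j l"
    if "s > 0" "n \<ge> k" and id: "\<And>a :: nat \<Rightarrow> 'x \<Rightarrow> real. bdf_identity k \<beta>' s n a"
      and "j \<in> {1..k}" "l \<in> {0..k - j}" for s n \<beta>' j l
  proof -
    \<comment> \<open>\<open>n - (n - i) = i\<close> holds only for \<open>i \<le> n\<close>, but
      the form reads \<open>v\<close> only up to \<open>k \<le> n\<close>.\<close>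
    have fdiff_form_cong: "fdiff_form k \<alpha> (\<lambda>i. v (n - (n - i))) = fdiff_form k \<alpha> v" for \<alpha> v
    proof -
      have "fdiff i (\<lambda>i. v (n - (n - i))) m = fdiff i v m" if "m + i \<le> n" for i m
        using that by (induction i arbitrary: m) auto
      then show ?thesis
        unfolding fdiff_form_def using \<open>n \<ge> k\<close> by (intro sum.cong) auto
    qed
    have "fdiff_form k (\<lambda>j l. \<beta>' j l + (-1) * \<beta> j l) v = 0" for v
    proof -
      \<comment> \<open>Sequences of constant functions already realise every \<open>v\<close> on
        the positions that are read.\<close>
      have "fdiff_form k \<beta> v = fdiff_form k \<beta>' v"
        using id[of "\<lambda>m _. v (n - m)"] identity_iff[OF that(1,2)] fdiff_form_cong by simp
      then show ?thesis
        unfolding fdiff_form_add[symmetric] fdiff_form_scale[symmetric] by simp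
    qed
    then have "\<beta>' j l + (-1) * \<beta> j l = 0"
      using fdiff_form_coeffs_eq_0[of k "\<lambda>j l. \<beta>' j l + (-1) * \<beta> j l" j l] that by auto
    then show ?thesis by simp
  qed
  then show ?thesis using identity_iff by blast
qed

end
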